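(* For any $\epsilon>0$, there is a signed graph $\Gamma$ whose underlying graph is a (finite) simple bipartite planar graph such that $\chi_c(\Gamma)>4-2\epsilon$.
   Context: A signed graph $(G,\sigma)$ is a graph $G$ with a signature $\sigma:E(G)\to\{+,-\}$. For real $r\ge 1$, $C^r$ is the circle of circumference $r$ (points are $[0,r)$), $d_{(\mathrm{mod}\, r)}(x,y)$ is the length of the shorter arc of $C^r$ between $x$ and $y$, and the antipodal $\bar x$ of $x$ is the point at distance $r/2$ from $x$. A circular $r$-coloring of $(G,\sigma)$ is a map $f:V(G)\to C^r$ such that $d_{(\mathrm{mod}\, r)}(f(u),f(v))\ge 1$ for each positive edge $uv$ and $d_{(\mathrm{mod}\, r)}(f(u),\overline{f(v)})\ge 1$ for each negative edge $uv$. $\chi_c(G,\sigma)=\inf\{r\ge 1: (G,\sigma)\text{ admits a circular } r\text{-coloring}\}$. *)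

theory Defs
  imports "HOL-Analysis.Analysis"
begin

section \<open>Graphs\<close>

text \<open>A graph is given by a vertex set and a set of edges, an edge being the set of its two ends.
  With this encoding there are no parallel edges, and the condition on cardinalities below
  excludes loops.\<close>

definition finite_simple_graph :: "'v set \<Rightarrow> 'v set set \<Rightarrow> bool" where
  "finite_simple_graph V E \<longleftrightarrow> finite V \<and> (\<forall>e\<in>E. e \<subseteq> V \<and> card e = 2)"

definition bipartite_graph :: "'v set \<Rightarrow> 'v set set \<Rightarrow> bool" where
  "bipartite_graph V E \<longleftrightarrow>
     (\<exists>A B. A \<union> B = V \<and> A \<inter> B = {} \<and> (\<forall>e\<in>E. \<exists>a\<in>A. \<exists>b\<in>B. e = {a, b}))"

text \<open>A drawing in the plane: \<open>p\<close> places the vertices at distinct points, and \<open>\<gamma> e\<close> is an arc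
  (an injective path) joining the ends of \<open>e\<close>. An arc contains no vertex other than its ends, and
  two different arcs meet at most in ends that their edges have in common.\<close>

definition plane_drawing ::
  "'v set \<Rightarrow> 'v set set \<Rightarrow> ('v \<Rightarrow> complex) \<Rightarrow> ('v set \<Rightarrow> real \<Rightarrow> complex) \<Rightarrow> bool" where
  "plane_drawing V E p \<gamma> \<longleftrightarrow>
     inj_on p V \<and>
     (\<forall>e\<in>E. arc (\<gamma> e) \<and> {pathstart (\<gamma> e), pathfinish (\<gamma> e)} = p ` e \<and>
            path_image (\<gamma> e) \<inter> p ` V = p ` e) \<and>
     (\<forall>e\<in>E. \<forall>e'\<in>E. e \<noteq> e' \<longrightarrow> path_image (\<gamma> e) \<inter> path_image (\<gamma> e') \<subseteq> p ` (e \<inter> e'))"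

definition planar_graph :: "'v set \<Rightarrow> 'v set set \<Rightarrow> bool" where
  "planar_graph V E \<longleftrightarrow> (\<exists>p \<gamma>. plane_drawing V E p \<gamma>)"


section \<open>Signed graphs and circular colorings\<close>

datatype edge_sign = Pos | Neg

record 'v signed_graph =
  verts :: "'v set"
  edges :: "'v set set"
  signature :: "'v set \<Rightarrow> edge_sign"

text \<open>The circle of circumference \<open>r\<close> is represented by \<open>{0..<r}\<close>; the two arcs between \<open>x\<close> and
  \<open>y\<close> then have lengths \<open>\<bar>x - y\<bar>\<close> and \<open>r - \<bar>x - y\<bar>\<close>.\<close>

definition circle :: "real \<Rightarrow> real set" where
  "circle r = {0..<r}"

definition circle_dist :: "real \<Rightarrow> real \<Rightarrow> real \<Rightarrow> real" where
  "circle_dist r x y = min \<bar>x - y\<bar> (r - \<bar>x - y\<bar>)"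

definition antipode :: "real \<Rightarrow> real \<Rightarrow> real" where
  "antipode r x = (THE y. y \<in> circle r \<and> circle_dist r x y = r / 2)"

lemma antipode_eq:
  assumes "x \<in> circle r"
  shows "antipode r x = (if x < r / 2 then x + r / 2 else x - r / 2)"
  unfolding antipode_def
  using assms by (intro the_equality) (auto simp: circle_def circle_dist_def min_def abs_if field_simps split: if_splits)

definition circular_coloring :: "'v signed_graph \<Rightarrow> real \<Rightarrow> ('v \<Rightarrow> real) \<Rightarrow> bool" where
  "circular_coloring \<Gamma> r f \<longleftrightarrow>
     f ` verts \<Gamma> \<subseteq> circle r \<and>
     (\<forall>u v. {u, v} \<in> edges \<Gamma> \<and> signature \<Gamma> {u, v} = Pos \<longrightarrow> circle_dist r (f u) (f v) \<ge> 1) \<and>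
     (\<forall>u v. {u, v} \<in> edges \<Gamma> \<and> signature \<Gamma> {u, v} = Neg \<longrightarrow>
        circle_dist r (f u) (antipode r (f v)) \<ge> 1)"

definition circular_chromatic_number :: "'v signed_graph \<Rightarrow> real" where
  "circular_chromatic_number \<Gamma> = Inf {r. r \<ge> 1 \<and> (\<exists>f. circular_coloring \<Gamma> r f)}"

text \<open>For finite simple graphs the infimum is taken over a nonempty set that is bounded below.\<close>

lemma circular_coloring_exists:
  assumes "finite_simple_graph (verts \<Gamma>) (edges \<Gamma>)"
  shows "\<exists>r\<ge>1. \<exists>f. circular_coloring \<Gamma> r f"
proof -
  have fin: "finite (verts \<Gamma>)" and edge: "\<And>e. e \<in> edges \<Gamma> \<Longrightarrow> e \<subseteq> verts \<Gamma> \<and> card e = 2"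
    using assms by (auto simp: finite_simple_graph_def)
  obtain h :: "'a \<Rightarrow> nat" where h: "inj_on h (verts \<Gamma>)"
    using fin finite_imp_inj_to_nat_seg by metis
  obtain n where n: "\<And>v. v \<in> verts \<Gamma> \<Longrightarrow> h v < n"
    using fin finite_nat_set_iff_bounded[of "h ` verts \<Gamma>"] by auto
  define r where "r = 2 * real n + 2"
  define f where "f v = real (h v)" for v
  have inC: "f v \<in> circle r" if "v \<in> verts \<Gamma>" for v
    using n[OF that] by (auto simp: f_def circle_def r_def)
  have far: "\<bar>f u - f v\<bar> \<ge> 1 \<and> f u < real n \<and> f v < real n \<and> 0 \<le> f u \<and> 0 \<le> f v \<and> v \<in> verts \<Gamma>"
    if "{u, v} \<in> edges \<Gamma>" for u v
  proof -
    have "u \<in> verts \<Gamma>" "v \<in> verts \<Gamma>" "u \<noteq> v" using edge[OF that] by (auto simp: card_insert_if)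
    moreover from this have "h u \<noteq> h v" using h by (auto dest: inj_onD)
    ultimately show ?thesis using n by (auto simp: f_def)
  qed
  have "circle_dist r (f u) (f v) \<ge> 1" if "{u, v} \<in> edges \<Gamma>" for u v
    using far[OF that] by (auto simp: circle_dist_def r_def)
  moreover have "circle_dist r (f u) (antipode r (f v)) \<ge> 1" if "{u, v} \<in> edges \<Gamma>" for u v
    using far[OF that] antipode_eq[OF inC[of v]]
    by (auto simp: circle_dist_def r_def field_simps split: if_splits)
  ultimately have "circular_coloring \<Gamma> r f"
    using inC by (auto simp: circular_coloring_def)
  moreover have "r \<ge> 1" by (simp add: r_def)
  ultimately show ?thesis by blast
qed

end

theory Submission
  imports Defs
begin

text \<open>Let \<open>r < 4\<close> and \<open>d = 2 - r / 2\<close>. If \<open>x\<close> and \<open>x'\<close> have distance \<open>p\<close> on the circle, then the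
  points that may be joined to \<open>x\<close> by a positive and to \<open>x'\<close> by a negative edge form an arc of
  length \<open>p - d\<close>. Hence in a chain of pairs of vertices, where every vertex of a pair is joined to
  the first vertex of the preceding pair by a positive edge and to the second one by a negative
  edge, the distance within a pair drops by at least \<open>d\<close> in every step. As the distance of the
  first pair is at most \<open>r / 2\<close>, a chain of \<open>k\<close> steps has no coloring once \<open>k * d > r / 2\<close>. Such a
  chain is bipartite, and it is drawn as a sequence of nested quadrilaterals with the pairs placed
  alternately on the two coordinate axes.\<close>

text \<open>Every \<open>x\<close> lies on a half circle from \<open>y\<close> to its antipode. A
  negative edge thus becomes an upper bound on the distance of its ends.\<close>

lemma circle_dist_antipode:
  assumes "x \<in> circle r" "y \<in> circle r"
  shows "circle_dist r x (antipode r y) = r / 2 - circle_dist r x y"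
  using assms by (auto simp: antipode_eq circle_dist_def circle_def min_def abs_if field_simps)

lemma circle_dist_bounds:
  assumes "x \<in> circle r" "y \<in> circle r"
  shows "0 \<le> circle_dist r x y" "circle_dist r x y \<le> r / 2"
  using assms by (auto simp: circle_dist_def circle_def min_def abs_if field_simps)

text \<open>Take \<open>x = 0\<close> and \<open>x' = p\<close> with
  \<open>0 \<le> p \<le> r / 2\<close>. Modulo \<open>r\<close>, both \<open>y\<close> and
  \<open>y'\<close> lie in \<open>[1, r - 1]\<close> and in
  \<open>[p - r / 2 + 1, p + r / 2 - 1]\<close>. As \<open>r < 4\<close>, these arcs meet only in
  \<open>[1, p + r / 2 - 1]\<close>.\<close>

lemma circle_dist_drop:
  assumes "x \<in> circle r" "x' \<in> circle r" "y \<in> circle r" "y' \<in> circle r" "r < 4"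
    and "circle_dist r x y \<ge> 1" "circle_dist r x y' \<ge> 1"
    and "circle_dist r x' y \<le> r / 2 - 1" "circle_dist r x' y' \<le> r / 2 - 1"
  shows "circle_dist r y y' + (2 - r / 2) \<le> circle_dist r x x'"
  using assms unfolding circle_dist_def circle_def atLeastLessThan_iff min_def abs_if
  by (smt (verit) field_sum_of_halves)

section \<open>The chain and its bipartition\<close>

text \<open>Vertices \<open>2 * j\<close> and \<open>2 * j + 1\<close> form pair \<open>j\<close>,
  so \<open>v div 2\<close> is the pair of \<open>v\<close>.\<close>

definition chain_edges :: "nat \<Rightarrow> nat set set" where
  "chain_edges k = {{u, v} |u v. v div 2 = Suc (u div 2) \<and> v div 2 \<le> k}"

text \<open>\<open>Min e\<close> is the end of \<open>e\<close> in the earlier pair; it is even iff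
  it is the first vertex of that pair.\<close>

definition chain :: "nat \<Rightarrow> nat signed_graph" where
  "chain k = \<lparr>verts = {v. v div 2 \<le> k}, edges = chain_edges k,
     signature = (\<lambda>e. if even (Min e) then Pos else Neg)\<rparr>"

lemma chain_simps [simp]:
  "verts (chain k) = {v. v div 2 \<le> k}" "edges (chain k) = chain_edges k"
  by (simp_all add: chain_def)

lemma chain_edgeI: "v div 2 = Suc (u div 2) \<Longrightarrow> v div 2 \<le> k \<Longrightarrow> {u, v} \<in> chain_edges k"
  unfolding chain_edges_def by blast

lemma chain_edgeE:
  assumes "e \<in> chain_edges k"
  obtains u v where "e = {u, v}" "u < v" "v div 2 = Suc (u div 2)" "v div 2 \<le> k"
proof -
  obtain u v where uv: "e = {u, v}" "v div 2 = Suc (u div 2)" "v div 2 \<le> k"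
    using assms by (auto simp: chain_edges_def)
  moreover have "u < v"
    using uv(2) by linarith
  ultimately show thesis
    using that by blast
qed

lemma finite_simple_chain: "finite_simple_graph (verts (chain k)) (edges (chain k))"
proof -
  have "{v. v div 2 \<le> k} \<subseteq> {..2 * k + 1}"
    by auto
  then have "finite {v. v div 2 \<le> k}"
    using finite_subset by blast
  then show ?thesis
    by (auto simp: finite_simple_graph_def elim!: chain_edgeE)
qed

lemma bipartite_chain: "bipartite_graph (verts (chain k)) (edges (chain k))"
  unfolding bipartite_graph_def chain_simps
proof (intro exI conjI ballI)
  show "{v. v div 2 \<le> k \<and> even (v div 2)} \<union> {v. v div 2 \<le> k \<and> odd (v div 2)} = {v. v div 2 \<le> k}"
    by auto
  show "{v. v div 2 \<le> k \<and> even (v div 2)} \<inter> {v. v div 2 \<le> k \<and> odd (v div 2)} = {}"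
    by auto
  fix e
  assume "e \<in> chain_edges k"
  then obtain u v where uv: "e = {u, v}" "v div 2 = Suc (u div 2)" "v div 2 \<le> k"
    by (rule chain_edgeE)
  show "\<exists>a\<in>{v. v div 2 \<le> k \<and> even (v div 2)}. \<exists>b\<in>{v. v div 2 \<le> k \<and> odd (v div 2)}. e = {a, b}"
  proof (cases "even (u div 2)")
    case True
    with uv show ?thesis by (intro bexI[of _ u] bexI[of _ v]) auto
  next
    case False
    with uv show ?thesis by (intro bexI[of _ v] bexI[of _ u]) auto
  qed
qed

section \<open>Colorings of the chain\<close>

lemma chain_coloring_bound:
  assumes "circular_coloring (chain k) r f" "r < 4"
  shows "real k * (2 - r / 2) \<le> r / 2"
proof -
  define D where "D j = circle_dist r (f (2 * j)) (f (Suc (2 * j)))" for j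
  have circ: "f v \<in> circle r" if "v div 2 \<le> k" for v
    using assms(1) that by (auto simp: circular_coloring_def)
  have pos: "circle_dist r (f (2 * j)) (f v) \<ge> 1"
    if "j < k" "v div 2 = Suc j" for j v
  proof -
    have "2 * j < v" using that by linarith
    then have "signature (chain k) {2 * j, v} = Pos"
      by (simp add: chain_def)
    moreover have "{2 * j, v} \<in> edges (chain k)"
      using that by (simp add: chain_edgeI)
    ultimately show ?thesis
      using assms(1) by (auto simp: circular_coloring_def)
  qed
  have neg: "circle_dist r (f (Suc (2 * j))) (f v) \<le> r / 2 - 1"
    if "j < k" "v div 2 = Suc j" for j v
  proof -
    have "Suc (2 * j) < v" using that by linarith
    then have "signature (chain k) {Suc (2 * j), v} = Neg"
      by (simp add: chain_def)
    moreover have "{Suc (2 * j), v} \<in> edges (chain k)"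
      using that by (simp add: chain_edgeI)
    ultimately have "circle_dist r (f (Suc (2 * j))) (antipode r (f v)) \<ge> 1"
      using assms(1) by (auto simp: circular_coloring_def)
    then show ?thesis
      using that by (simp add: circle_dist_antipode circ)
  qed
  have step: "D (Suc j) + (2 - r / 2) \<le> D j" if "j < k" for j
    unfolding D_def using that assms(2)
    by (intro circle_dist_drop pos neg circ) auto
  have "real j * (2 - r / 2) + D j \<le> D 0" if "j \<le> k" for j
    using that
  proof (induction j)
    case (Suc j)
    then show ?case using step[of j] by (simp add: field_simps)
  qed simp
  \<comment> \<open>It remains to use \<open>D k \<ge> 0\<close> and
    \<open>D 0 \<le> r / 2\<close>.\<close>
  from this[of k] show ?thesis
    using circle_dist_bounds[OF circ circ, of "2 * k" "Suc (2 * k)"]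
      circle_dist_bounds[OF circ circ, of 0 "Suc 0"] by (simp add: D_def)
qed

section \<open>The plane drawing\<close>

text \<open>Pair \<open>j\<close> sits at \<open>j + 1\<close> and \<open>- (j + 1)\<close> on its
  axis; the shift by one keeps pair 0 from collapsing to the origin.\<close>

definition place :: "nat \<Rightarrow> complex" where
  "place v = (let c = (if even v then 1 else - 1) * (real (v div 2) + 1)
     in if even (v div 2) then Complex c 0 else Complex 0 c)"

text \<open>This norm is affine on each closed quadrant, and every edge stays in one.\<close>

definition taxicab :: "complex \<Rightarrow> real" where
  "taxicab z = \<bar>Re z\<bar> + \<bar>Im z\<bar>"

lemma taxicab_place [simp]: "taxicab (place v) = real (v div 2) + 1"
  by (auto simp: taxicab_def place_def Let_def)

lemma nat_eq_if_half_parity_eq: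
  fixes u v :: nat
  assumes "u div 2 = v div 2" "even u \<longleftrightarrow> even v"
  shows "u = v"
  using assms by (metis div_mult_mod_eq parity_cases)

lemma place_inject [simp]: "place u = place v \<longleftrightarrow> u = v"
proof
  assume eq: "place u = place v"
  then have "taxicab (place u) = taxicab (place v)"
    by simp
  then have lay: "u div 2 = v div 2"
    by simp
  moreover from eq lay have "even u \<longleftrightarrow> even v"
    by (auto simp: place_def Let_def split: if_splits)
  ultimately show "u = v"
    by (rule nat_eq_if_half_parity_eq)
qed simp

text \<open>The parameter of a point on an edge can thus be read off from its taxicab norm.\<close>

lemma taxicab_edge:
  assumes "v div 2 = Suc (u div 2)" "0 \<le> t" "t \<le> 1"
  shows "taxicab ((1 - t) *\<^sub>R place u + t *\<^sub>R place v) = real (u div 2) + 1 + t"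
proof -
  have "\<bar>- 1 - real n\<bar> = 1 + real n" "\<bar>1 + real n\<bar> = 1 + real n" "\<bar>- 2 - real n\<bar> = 2 + real n" for n
    by simp_all
  with assms show ?thesis
    by (auto simp: taxicab_def place_def Let_def abs_mult) (simp_all add: algebra_simps)
qed

text \<open>Vertices have integer norm, while inside an edge the norm lies strictly between
  consecutive integers.\<close>

lemma edge_meets_vertex:
  assumes "v div 2 = Suc (u div 2)" "place w \<in> closed_segment (place u) (place v)"
  shows "w \<in> {u, v}"
proof -
  obtain t where t: "0 \<le> t" "t \<le> 1" and eq: "place w = (1 - t) *\<^sub>R place u + t *\<^sub>R place v"
    using assms(2) by (auto simp: closed_segment_def)
  then have "real (w div 2) = real (u div 2) + t"
    using taxicab_edge[OF assms(1) t] by (metis add.commute add.left_commute add_left_cancel taxicab_place)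
  with t have "t = 0 \<or> t = 1"
    using of_nat_mono[of "w div 2" "u div 2"] of_nat_mono[of "Suc (u div 2)" "w div 2"]
    by (cases "w div 2 \<le> u div 2") auto
  with eq show ?thesis
    by auto
qed

text \<open>A common point is an end of the first edge, covered by \<open>edge_meets_vertex\<close>,
  or comparing norms puts both edges between the same pairs with equal parameters.\<close>

lemma edges_meet:
  assumes uv: "v div 2 = Suc (u div 2)" and uv': "v' div 2 = Suc (u' div 2)"
    and z: "z \<in> closed_segment (place u) (place v)" "z \<in> closed_segment (place u') (place v')"
    and le: "u div 2 \<le> u' div 2" and ne: "{u, v} \<noteq> {u', v'}"
  shows "z \<in> place ` ({u, v} \<inter> {u', v'})"
proof -
  obtain t where t: "0 \<le> t" "t \<le> 1" and zt: "z = (1 - t) *\<^sub>R place u + t *\<^sub>R place v"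
    using z(1) by (auto simp: closed_segment_def)
  obtain t' where t': "0 \<le> t'" "t' \<le> 1" and zt': "z = (1 - t') *\<^sub>R place u' + t' *\<^sub>R place v'"
    using z(2) by (auto simp: closed_segment_def)
  have norms: "real (u div 2) + t = real (u' div 2) + t'"
    using taxicab_edge[OF uv t] taxicab_edge[OF uv' t'] zt zt' by simp
  consider "t = 1" | "t = 0" | "0 < t" "t < 1"
    using t by linarith
  then show ?thesis
  proof cases
    case 1
    then have "z = place v" using zt by simp
    with z edge_meets_vertex[OF uv'] show ?thesis by auto
  next
    case 2
    then have "z = place u" using zt by simp
    with z edge_meets_vertex[OF uv'] show ?thesis by auto
  next
    case 3
    with norms t' le have lay: "u div 2 = u' div 2"
      by linarith
    with norms have "t = t'"
      by simp
    with zt zt' have eq: "(1 - t) *\<^sub>R place u + t *\<^sub>R place v = (1 - t) *\<^sub>R place u' + t *\<^sub>R place v'"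
      by simp
    \<comment> \<open>Otherwise \<open>place u' = - place u\<close>, and the two points differ in
      the coordinate along the axis of that pair, since \<open>t < 1\<close>.\<close>
    have "u = u'"
    proof (rule ccontr)
      assume "u \<noteq> u'"
      with lay have "even u \<longleftrightarrow> odd u'"
        using nat_eq_if_half_parity_eq by blast
      with lay eq uv uv' 3 show False
        by (auto simp: place_def Let_def complex_eq_iff split: if_splits)
    qed
    moreover from this eq 3 have "v = v'"
      by simp
    ultimately show ?thesis using ne by simp
  qed
qed

lemma planar_chain: "planar_graph (verts (chain k)) (edges (chain k))"
proof -
  define \<gamma> where "\<gamma> e = linepath (place (Min e)) (place (Max e))" for e
  have \<gamma>: "\<gamma> {u, v} = linepath (place u) (place v)" if "u < v" for u v
    using that by (simp add: \<gamma>_def)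
  have "plane_drawing (verts (chain k)) (edges (chain k)) place \<gamma>"
    unfolding plane_drawing_def chain_simps
  proof (intro conjI ballI impI)
    show "inj_on place {v. v div 2 \<le> k}"
      by (auto simp: inj_on_def)
  next
    fix e
    assume "e \<in> chain_edges k"
    then obtain u v where uv: "e = {u, v}" "u < v" "v div 2 = Suc (u div 2)" "v div 2 \<le> k"
      by (rule chain_edgeE)
    then show "arc (\<gamma> e)" "{pathstart (\<gamma> e), pathfinish (\<gamma> e)} = place ` e"
      by (auto simp: \<gamma>)
    show "path_image (\<gamma> e) \<inter> place ` {v. v div 2 \<le> k} = place ` e"
      using uv by (auto simp: \<gamma> dest: edge_meets_vertex)
  next
    fix e e'
    assume "e \<in> chain_edges k" "e' \<in> chain_edges k" and ne: "e \<noteq> e'"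
    then obtain u v u' v' where
      uv: "e = {u, v}" "u < v" "v div 2 = Suc (u div 2)" and
      uv': "e' = {u', v'}" "u' < v'" "v' div 2 = Suc (u' div 2)"
      by (metis chain_edgeE)
    show "path_image (\<gamma> e) \<inter> path_image (\<gamma> e') \<subseteq> place ` (e \<inter> e')"
    proof
      fix z
      assume "z \<in> path_image (\<gamma> e) \<inter> path_image (\<gamma> e')"
      then have "z \<in> closed_segment (place u) (place v)" "z \<in> closed_segment (place u') (place v')"
        using uv uv' by (auto simp: \<gamma>)
      \<comment> \<open>The two instances cover both orders of the inner pairs.\<close>
      with edges_meet[of v u v' u' z] edges_meet[of v' u' v u z] uv uv' ne
      show "z \<in> place ` (e \<inter> e')"
        by (metis Int_commute nle_le)
    qed
  qed
  then show ?thesis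
    by (auto simp: planar_graph_def)
qed

theorem corollary5p12:
  fixes \<epsilon> :: real
  assumes "\<epsilon> > 0"
  shows "\<exists>\<Gamma> :: nat signed_graph.
           finite_simple_graph (verts \<Gamma>) (edges \<Gamma>) \<and>
           bipartite_graph (verts \<Gamma>) (edges \<Gamma>) \<and>
           planar_graph (verts \<Gamma>) (edges \<Gamma>) \<and>
           circular_chromatic_number \<Gamma> > 4 - 2 * \<epsilon>"
proof -
  \<comment> \<open>For \<open>r < 4 - \<epsilon>\<close> every step of the chain loses at least
    \<open>\<epsilon> / 2\<close>, so \<open>k\<close> steps lose more than 2, which exceeds
    \<open>r / 2\<close>.\<close>
  obtain k :: nat where k: "4 / \<epsilon> < real k"
    using reals_Archimedean2 by blast
  \<comment> \<open>An infimum inherits only a non-strict bound; the spare \<open>\<epsilon>\<close>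
    makes the final one strict.\<close>
  have "4 - \<epsilon> \<le> circular_chromatic_number (chain k)"
    unfolding circular_chromatic_number_def
  proof (rule cInf_greatest)
    show "{r. r \<ge> 1 \<and> (\<exists>f. circular_coloring (chain k) r f)} \<noteq> {}"
      using circular_coloring_exists[OF finite_simple_chain[of k]] by auto
    fix r
    assume "r \<in> {r. r \<ge> 1 \<and> (\<exists>f. circular_coloring (chain k) r f)}"
    then obtain f where f: "circular_coloring (chain k) r f"
      by blast
    show "4 - \<epsilon> \<le> r"
    proof (rule ccontr)
      assume "\<not> 4 - \<epsilon> \<le> r"
      then have "r < 4" and r: "\<epsilon> / 2 \<le> 2 - r / 2"
        using assms by auto
      then have "real k * (\<epsilon> / 2) \<le> r / 2"
        using chain_coloring_bound[OF f] mult_left_mono[OF r, of "real k"] by simp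
      with k assms \<open>r < 4\<close> show False
        by (simp add: field_simps)
    qed
  qed
  with assms have "circular_chromatic_number (chain k) > 4 - 2 * \<epsilon>"
    by linarith
  then show ?thesis
    using finite_simple_chain bipartite_chain planar_chain by blast
qed

end
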